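(* Let $\sigma>1$ be fixed. Then the following two statements are equivalent: (i) (Fermat–Wiles theorem) there are no positive integers $x,y,z,n$ with $n\geq 3$ and $x^n+y^n=z^n$; (ii) for all positive integers $x,y,z,n$ with $n\geq 3$, $$\lim_{\tau\to\infty}\frac{1}{\tau}\int_1^{\frac{x^n+y^n}{z^n}\frac{\tau}{\zeta(2\sigma)}}|\zeta(\sigma+it)|^2\,{\rm d}t\neq 1 .$$
   Context: $\zeta$ denotes the Riemann zeta-function. Numbers of the form $\frac{x^n+y^n}{z^n}$ with $x,y,z,n\in\mathbb{N}$, $n\ge 3$, are called Fermat's rationals. *)

theory Defs
  imports "HOL-Analysis.Analysis"
begin

text \<open>
  The Riemann zeta function, given by its Dirichlet series. This is its defining expression for
  \<open>Re s > 1\<close>; no analytic continuation is provided, so outside that half-plane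
  the value has no meaning. On real \<open>s > 1\<close> the value is real.
\<close>

definition zeta :: "complex \<Rightarrow> complex" where
  "zeta s = (\<Sum>k. 1 / of_nat (Suc k) powr s)"

end

theory Submission
  imports Defs "HOL-Real_Asymp.Real_Asymp"
begin

text \<open>
  The mean value \<open>(1/T) \<integral>\<^sub>1\<^sup>T |\<zeta>(\<sigma> + it)|\<^sup>2 dt\<close> tends to \<open>\<zeta>(2\<sigma>)\<close>: for a Dirichlet polynomial only the
  diagonal terms survive the averaging, and on the line \<open>Re s = \<sigma> > 1\<close> the partial sums of the
  Dirichlet series converge uniformly, which allows the two limits to be exchanged. Rescaling,
  the limit in (ii) is exactly the Fermat rational \<open>(x\<^sup>n + y\<^sup>n) / z\<^sup>n\<close>.
\<close>

section \<open>Mean values of continuous functions on the half-line\<close>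

text \<open>Continuity is part of the notion so that every integral over \<open>{1..T}\<close>
  exists, which sums and uniform limits then inherit.\<close>

definition has_mean :: "(real \<Rightarrow> real) \<Rightarrow> real \<Rightarrow> bool" where
  "has_mean f m \<longleftrightarrow> continuous_on UNIV f \<and> ((\<lambda>T. integral {1..T} f / T) \<longlongrightarrow> m) at_top"

lemma has_mean_integrable: "has_mean f m \<Longrightarrow> f integrable_on {1..T}"
  unfolding has_mean_def
  by (meson continuous_on_subset integrable_continuous_interval top_greatest)

lemma has_mean_cmult:
  assumes "has_mean f m"
  shows "has_mean (\<lambda>t. c * f t) (c * m)"
proof -
  have "((\<lambda>T. c * (integral {1..T} f / T)) \<longlongrightarrow> c * m) at_top"
    using assms unfolding has_mean_def by (intro tendsto_intros) auto
  with assms show ?thesis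
    unfolding has_mean_def by (auto intro!: continuous_intros)
qed

lemma has_mean_sum:
  assumes "finite A" "\<And>k. k \<in> A \<Longrightarrow> has_mean (f k) (m k)"
  shows "has_mean (\<lambda>t. \<Sum>k\<in>A. f k t) (\<Sum>k\<in>A. m k)"
proof -
  have "((\<lambda>T. \<Sum>k\<in>A. integral {1..T} (f k) / T) \<longlongrightarrow> (\<Sum>k\<in>A. m k)) at_top"
    using assms unfolding has_mean_def by (intro tendsto_intros) auto
  moreover have "(\<lambda>T. \<Sum>k\<in>A. integral {1..T} (f k) / T) =
      (\<lambda>T. integral {1..T} (\<lambda>t. \<Sum>k\<in>A. f k t) / T)"
    by (simp add: integral_sum[OF assms(1) has_mean_integrable[OF assms(2)]] sum_divide_distrib)
  ultimately show ?thesis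
    using assms unfolding has_mean_def by (auto intro!: continuous_intros)
qed

text \<open>For a nonzero frequency the antiderivative \<open>sin (\<omega> * t) / \<omega>\<close>
  stays bounded, so division by \<open>T\<close> sends the average to 0; frequency 0 leaves the
  constant 1.\<close>

lemma has_mean_cos: "has_mean (\<lambda>t. cos (\<omega> * t)) (if \<omega> = 0 then 1 else 0)"
proof (cases "\<omega> = 0")
  case True
  have "((\<lambda>T::real. (T - 1) / T) \<longlongrightarrow> 1) at_top"
    by real_asymp
  \<comment> \<open>For \<open>T < 1\<close> the interval is empty and its integral is 0 rather than
    \<open>T - 1\<close>, so the equality is only eventual.\<close>
  moreover have "\<forall>\<^sub>F T::real in at_top. (T - 1) / T = integral {1..T} (\<lambda>t. 1) / T"
    using eventually_ge_at_top[of 1] by eventually_elim simp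
  ultimately have "((\<lambda>T::real. integral {1..T} (\<lambda>t. 1::real) / T) \<longlongrightarrow> 1) at_top"
    by (rule Lim_transform_eventually)
  with True show ?thesis
    by (simp add: has_mean_def)
next
  case False
  have int: "integral {1..T} (\<lambda>t. cos (\<omega> * t)) = (sin (\<omega> * T) - sin \<omega>) / \<omega>" if "T \<ge> 1" for T
  proof -
    have "((\<lambda>t. cos (\<omega> * t)) has_integral sin (\<omega> * T) / \<omega> - sin (\<omega> * 1) / \<omega>) {1..T}"
      using that False
      by (intro fundamental_theorem_of_calculus)
        (auto intro!: derivative_eq_intros simp flip: has_real_derivative_iff_has_vector_derivative)
    then show ?thesis
      by (simp add: integral_unique diff_divide_distrib)
  qed
  have "((\<lambda>T. integral {1..T} (\<lambda>t. cos (\<omega> * t)) / T) \<longlongrightarrow> 0) at_top"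
  proof (rule Lim_null_comparison)
    show "((\<lambda>T. 2 / \<bar>\<omega>\<bar> / T) \<longlongrightarrow> 0) at_top"
      by real_asymp
    show "\<forall>\<^sub>F T in at_top. norm (integral {1..T} (\<lambda>t. cos (\<omega> * t)) / T) \<le> 2 / \<bar>\<omega>\<bar> / T"
      using eventually_ge_at_top[of 1]
    proof eventually_elim
      case (elim T)
      have "\<bar>sin (\<omega> * T) - sin \<omega>\<bar> \<le> 2"
        using abs_triangle_ineq4[of "sin (\<omega> * T)" "sin \<omega>"] abs_sin_le_one[of "\<omega> * T"]
          abs_sin_le_one[of \<omega>] by linarith
      with elim False show ?case
        by (simp add: int abs_mult divide_right_mono)
    qed
  qed
  with False show ?thesis
    by (auto simp: has_mean_def intro!: continuous_intros)
qed

text \<open>A uniform error below \<open>e\<close> in the functions gives an error below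
  \<open>e\<close> in the averages for all \<open>T \<ge> 1\<close> at once. This uniformity in
  \<open>T\<close> permits swapping the limits in \<open>N\<close> and \<open>T\<close>.\<close>

lemma has_mean_uniform_limit:
  assumes mean: "\<And>N. has_mean (f N) (m N)"
    and unif: "uniform_limit UNIV f g sequentially"
    and lim: "m \<longlonglongrightarrow> l"
  shows "has_mean g l"
proof -
  have cont: "continuous_on UNIV g"
    using mean by (intro uniform_limit_theorem[OF _ unif]) (auto simp: has_mean_def)
  have intg: "g integrable_on {1..T}" for T
    using cont by (meson continuous_on_subset integrable_continuous_interval top_greatest)
  \<comment> \<open>On \<open>T \<ge> 1\<close> the interval has length \<open>T - 1 < T\<close>, so
    dividing by \<open>T\<close> keeps the error strictly below \<open>e\<close>.\<close>
  have "uniform_limit {1..} (\<lambda>N T. integral {1..T} (f N) / T) (\<lambda>T. integral {1..T} g / T) sequentially"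
  proof (rule uniform_limitI)
    fix e :: real
    assume e: "e > 0"
    have "\<forall>\<^sub>F N in sequentially. \<forall>t\<in>UNIV. dist (f N t) (g t) < e"
      using unif e by (rule uniform_limitD)
    then show "\<forall>\<^sub>F N in sequentially. \<forall>T\<in>{1..}.
        dist (integral {1..T} (f N) / T) (integral {1..T} g / T) < e"
    proof (eventually_elim, intro ballI)
      fix N :: nat and T :: real
      assume N: "\<forall>t\<in>UNIV. dist (f N t) (g t) < e" and T: "T \<in> {1..}"
      have "norm (integral {1..T} (\<lambda>t. f N t - g t)) \<le> integral {1..T} (\<lambda>t. e)"
        using N by (intro integral_norm_bound_integral integrable_diff has_mean_integrable[OF mean] intg)
          (auto simp: dist_real_def less_imp_le)
      then have "\<bar>integral {1..T} (f N) - integral {1..T} g\<bar> \<le> e * (T - 1)"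
        using T by (simp add: integral_diff has_mean_integrable[OF mean] intg mult.commute)
      also have "\<dots> < e * T"
        using e by simp
      finally show "dist (integral {1..T} (f N) / T) (integral {1..T} g / T) < e"
        using T by (simp add: dist_real_def divide_less_eq flip: diff_divide_distrib)
    qed
  qed
  moreover have "\<forall>\<^sub>F N in sequentially. ((\<lambda>T. integral {1..T} (f N) / T) \<longlongrightarrow> m N) at_top"
    using mean by (simp add: has_mean_def)
  moreover have "\<forall>\<^sub>F T in at_top. T \<in> {1::real..}"
    using eventually_ge_at_top[of "1::real"] by simp
  ultimately have "((\<lambda>T. integral {1..T} g / T) \<longlongrightarrow> l) at_top"
    by (intro swap_uniform_limit'[OF _ lim _ _ sequentially_bot])
  with cont show ?thesis
    by (simp add: has_mean_def)
qed

text \<open>The squared modulus expands into cosines of frequency \<open>l j - l k\<close>.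
  Injectivity of \<open>l\<close> makes this frequency vanish only for \<open>j = k\<close>, so the
  averages of all cross terms tend to 0.\<close>

lemma has_mean_norm_sum_cis:
  assumes "finite A" "inj_on l A"
  shows "has_mean (\<lambda>t. (norm (\<Sum>k\<in>A. of_real (a k) * cis (- (l k * t))))\<^sup>2) (\<Sum>k\<in>A. (a k)\<^sup>2)"
proof -
  have "(norm (\<Sum>k\<in>A. of_real (a k) * cis (- (l k * t))))\<^sup>2 =
      (\<Sum>j\<in>A. \<Sum>k\<in>A. a j * a k * cos ((l j - l k) * t))" for t
  proof -
    have "(norm (\<Sum>k\<in>A. of_real (a k) * cis (- (l k * t))))\<^sup>2 =
        (\<Sum>k\<in>A. a k * cos (l k * t))\<^sup>2 + (\<Sum>k\<in>A. a k * sin (l k * t))\<^sup>2"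
      by (simp add: cmod_power2 sum_negf)
    also have "\<dots> = (\<Sum>j\<in>A. \<Sum>k\<in>A. a j * a k * cos ((l j - l k) * t))"
      by (simp add: power2_eq_square sum_product cos_diff left_diff_distrib algebra_simps
          flip: sum.distrib)
    finally show ?thesis .
  qed
  moreover have "has_mean (\<lambda>t. \<Sum>j\<in>A. \<Sum>k\<in>A. a j * a k * cos ((l j - l k) * t))
      (\<Sum>j\<in>A. \<Sum>k\<in>A. a j * a k * (if l j - l k = 0 then 1 else 0))"
    using assms(1) by (intro has_mean_sum has_mean_cmult has_mean_cos)
  moreover have "(\<Sum>k\<in>A. a j * a k * (if l j - l k = 0 then 1 else 0)) = (a j)\<^sup>2" if "j \<in> A" for j
  proof -
    have "(\<Sum>k\<in>A. a j * a k * (if l j - l k = 0 then 1 else 0)) =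
        (\<Sum>k\<in>A. if j = k then (a j)\<^sup>2 else 0)"
      using that assms(2) by (intro sum.cong) (auto simp: power2_eq_square dest: inj_onD)
    then show ?thesis
      using that assms(1) by simp
  qed
  ultimately show ?thesis
    by simp
qed

section \<open>The zeta function on the real axis and on vertical lines\<close>

lemma summable_Suc_powr: "s > 1 \<Longrightarrow> summable (\<lambda>k. real (Suc k) powr (- s))"
  using summable_Suc_iff[of "\<lambda>n. real n powr (- s)"] summable_real_powr_iff[of "- s"] by simp

text \<open>Passing to a real series serves twice: its positive terms show that the later division
  by zeta is legitimate, and at \<open>2 * \<sigma>\<close> it is the limit of the diagonal
  sums.\<close>

lemma zeta_of_real:
  assumes "s > 1"
  shows "zeta (of_real s) = of_real (\<Sum>k. real (Suc k) powr (- s))"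
proof -
  have "1 / of_nat (Suc k) powr of_real s = (of_real (real (Suc k) powr (- s)) :: complex)" for k
    using powr_of_real[of "real (Suc k)" s]
    by (simp add: powr_minus_divide del: of_nat_Suc)
  then show ?thesis
    unfolding zeta_def using suminf_of_real[OF summable_Suc_powr[OF assms], where 'a = complex]
    by (simp del: of_nat_Suc)
qed

lemma Re_zeta_pos:
  assumes "s > 1"
  shows "Re (zeta (of_real s)) > 0"
  unfolding zeta_of_real[OF assms] Re_complex_of_real
  by (rule suminf_pos[OF summable_Suc_powr[OF assms]]) simp

text \<open>Splitting each term into modulus and phase exhibits the truncated series as
  trigonometric sums with frequencies \<open>ln (real (Suc k))\<close>.\<close>

lemma zeta_Complex:
  "zeta (Complex \<sigma> t) = (\<Sum>k. of_real (real (Suc k) powr (- \<sigma>)) * cis (- (ln (real (Suc k)) * t)))"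
proof -
  have "1 / of_nat (Suc k) powr Complex \<sigma> t =
      of_real (real (Suc k) powr (- \<sigma>)) * cis (- (ln (real (Suc k)) * t))" for k
  proof -
    have ln: "Ln (of_nat (Suc k)) = of_real (ln (real (Suc k)))"
      using Ln_of_real[of "real (Suc k)"] by simp
    have "1 / of_nat (Suc k) powr Complex \<sigma> t = exp (- (Complex \<sigma> t * of_real (ln (real (Suc k)))))"
      by (simp add: powr_def exp_minus inverse_eq_divide ln del: of_nat_Suc)
    also have "\<dots> = of_real (real (Suc k) powr (- \<sigma>)) * cis (- (ln (real (Suc k)) * t))"
      by (simp add: exp_eq_polar powr_def mult.commute del: of_nat_Suc)
    finally show ?thesis .
  qed
  then show ?thesis
    unfolding zeta_def by simp
qed

lemma has_mean_norm_zeta: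
  assumes "\<sigma> > 1"
  shows "has_mean (\<lambda>t. (norm (zeta (Complex \<sigma> t)))\<^sup>2) (Re (zeta (of_real (2 * \<sigma>))))"
proof -
  define a where "a k = real (Suc k) powr (- \<sigma>)" for k
  define u where "u k t = of_real (a k) * cis (- (ln (real (Suc k)) * t))" for k t
  have a: "summable a"
    unfolding a_def using summable_Suc_powr[OF assms] .
  have a_sq: "(a k)\<^sup>2 = real (Suc k) powr (- (2 * \<sigma>))" for k
    by (simp add: a_def power2_eq_square flip: powr_add)
  have norm_u: "norm (u k t) = a k" for k t
    by (simp add: u_def norm_mult a_def)
  have zeta: "zeta (Complex \<sigma> t) = (\<Sum>k. u k t)" for t
    unfolding zeta_Complex u_def a_def ..
  have "uniform_limit UNIV (\<lambda>N t. \<Sum>k<N. u k t) (\<lambda>t. zeta (Complex \<sigma> t)) sequentially"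
    unfolding zeta using a by (intro Weierstrass_m_test) (auto simp: norm_u)
  \<comment> \<open>Squaring preserves uniform convergence only with a bound on the limit; the sum
    of the term moduli, \<open>suminf a\<close>, provides it.\<close>
  moreover have "bounded (range (\<lambda>t. norm (zeta (Complex \<sigma> t))))"
    unfolding bounded_iff zeta
    by (auto intro!: exI[of _ "suminf a"] norm_suminf_le a simp: norm_u)
  ultimately have unif: "uniform_limit UNIV (\<lambda>N t. (norm (\<Sum>k<N. u k t))\<^sup>2)
      (\<lambda>t. (norm (zeta (Complex \<sigma> t)))\<^sup>2) sequentially"
    unfolding power2_eq_square by (intro uniform_lim_mult uniform_limit_norm)
  \<comment> \<open>Distinct indices give distinct frequencies because \<open>ln\<close> is
    injective on positive reals.\<close>
  have "inj_on (\<lambda>k. ln (real (Suc k))) {..<N}" for N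
    by (auto simp: inj_on_def)
  then have mean: "has_mean (\<lambda>t. (norm (\<Sum>k<N. u k t))\<^sup>2) (\<Sum>k<N. (a k)\<^sup>2)" for N
    unfolding u_def by (intro has_mean_norm_sum_cis) auto
  have "(\<lambda>N. \<Sum>k<N. (a k)\<^sup>2) \<longlonglongrightarrow> Re (zeta (of_real (2 * \<sigma>)))"
    using assms summable_LIMSEQ[OF summable_Suc_powr[of "2 * \<sigma>"]]
    by (simp add: a_sq zeta_of_real del: of_real_mult)
  then show ?thesis
    by (rule has_mean_uniform_limit[OF mean unif])
qed

section \<open>Rescaling and the equivalence\<close>

text \<open>With \<open>Z\<close> the zeta value and \<open>T = c * (\<tau> / Z)\<close>, the factor
  \<open>1 / \<tau>\<close> equals \<open>(c / Z) / T\<close>. The limit is therefore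
  \<open>c / Z\<close> times the mean value \<open>Z\<close>.\<close>

lemma tendsto_zeta_mean_rescaled:
  assumes "\<sigma> > 1" "c > 0"
  shows "((\<lambda>\<tau>. 1 / \<tau> * (LBINT t = 1..ereal (c * (\<tau> / Re (zeta (of_real (2 * \<sigma>))))).
            (norm (zeta (Complex \<sigma> t)))\<^sup>2)) \<longlongrightarrow> c) at_top"
proof -
  define Z where "Z = Re (zeta (of_real (2 * \<sigma>)))"
  define f where "f t = (norm (zeta (Complex \<sigma> t)))\<^sup>2" for t
  have Z: "Z > 0"
    using Re_zeta_pos[of "2 * \<sigma>"] assms(1) by (simp add: Z_def)
  have mean: "has_mean f Z"
    using has_mean_norm_zeta[OF assms(1)] unfolding f_def Z_def .
  have lim: "filterlim (\<lambda>\<tau>. c * (\<tau> / Z)) at_top at_top"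
    using Z assms(2) by real_asymp
  have "((\<lambda>\<tau>. integral {1..c * (\<tau> / Z)} f / (c * (\<tau> / Z))) \<longlongrightarrow> Z) at_top"
    using mean filterlim_compose[OF _ lim] unfolding has_mean_def by blast
  then have "((\<lambda>\<tau>. c / Z * (integral {1..c * (\<tau> / Z)} f / (c * (\<tau> / Z)))) \<longlongrightarrow> c / Z * Z) at_top"
    by (intro tendsto_intros)
  moreover have "\<forall>\<^sub>F \<tau> in at_top. c / Z * (integral {1..c * (\<tau> / Z)} f / (c * (\<tau> / Z))) =
      1 / \<tau> * (LBINT t = 1..ereal (c * (\<tau> / Z)). f t)"
    \<comment> \<open>The upper endpoint must be at least 1: below that the interval integral is
      oriented backwards, while \<open>integral\<close> over the empty set is 0. Positivity of
      \<open>\<tau>\<close> justifies the cancellation.\<close>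
    using filterlim_at_top[THEN iffD1, OF lim, rule_format, of 1] eventually_gt_at_top[of 0]
  proof eventually_elim
    case (elim \<tau>)
    have "set_integrable lborel {1..c * (\<tau> / Z)} f"
      using mean unfolding has_mean_def
      by (meson borel_integrable_atLeastAtMost' continuous_on_subset top_greatest)
    then have "(LBINT t = 1..ereal (c * (\<tau> / Z)). f t) = integral {1..c * (\<tau> / Z)} f"
      using interval_integral_eq_integral[of 1 "c * (\<tau> / Z)" f] elim
      by (simp add: one_ereal_def)
    then show ?case
      using Z assms(2) elim by simp
  qed
  ultimately have "((\<lambda>\<tau>. 1 / \<tau> * (LBINT t = 1..ereal (c * (\<tau> / Z)). f t)) \<longlongrightarrow> c / Z * Z) at_top"
    by (rule Lim_transform_eventually)
  then show ?thesis
    using Z by (simp add: Z_def f_def)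
qed

theorem theorem1:
  fixes \<sigma> :: real
  assumes "\<sigma> > 1"
  shows "(\<not> (\<exists>(x::nat) (y::nat) (z::nat) (n::nat). x > 0 \<and> y > 0 \<and> z > 0 \<and> n \<ge> 3 \<and> x ^ n + y ^ n = z ^ n))
    \<longleftrightarrow>
    (\<forall>(x::nat) (y::nat) (z::nat) (n::nat). x > 0 \<and> y > 0 \<and> z > 0 \<and> n \<ge> 3 \<longrightarrow>
      (\<exists>L :: real.
        ((\<lambda>\<tau> :: real. 1 / \<tau> *
            (LBINT t = 1..ereal ((real x ^ n + real y ^ n) / real z ^ n
                                 * (\<tau> / Re (zeta (of_real (2 * \<sigma>))))).
              (norm (zeta (Complex \<sigma> t)))\<^sup>2)) \<longlongrightarrow> L) at_top
        \<and> L \<noteq> 1))"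
proof -
  have limit_iff: "(\<exists>L :: real.
        ((\<lambda>\<tau> :: real. 1 / \<tau> *
            (LBINT t = 1..ereal ((real x ^ n + real y ^ n) / real z ^ n
                                 * (\<tau> / Re (zeta (of_real (2 * \<sigma>))))).
              (norm (zeta (Complex \<sigma> t)))\<^sup>2)) \<longlongrightarrow> L) at_top
        \<and> L \<noteq> 1) \<longleftrightarrow> x ^ n + y ^ n \<noteq> z ^ n" (is "(\<exists>L. (?F \<longlongrightarrow> L) at_top \<and> L \<noteq> 1) \<longleftrightarrow> _")
    if "x > 0" "y > 0" "z > 0" for x y z n :: nat
  proof -
    let ?c = "(real x ^ n + real y ^ n) / real z ^ n"
    have "?c > 0"
      using that by (simp add: add_pos_pos)
    then have "(?F \<longlongrightarrow> ?c) at_top"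
      by (rule tendsto_zeta_mean_rescaled[OF assms])
    \<comment> \<open>Since limits are unique, the existential over \<open>L\<close> collapses to
      the single condition \<open>?c \<noteq> 1\<close>.\<close>
    then have F_iff: "(?F \<longlongrightarrow> L) at_top \<longleftrightarrow> L = ?c" for L
      using tendsto_unique[OF trivial_limit_at_top_linorder] by blast
    have "?c = 1 \<longleftrightarrow> real (x ^ n + y ^ n) = real (z ^ n)"
      using that by auto
    then show ?thesis
      unfolding F_iff of_nat_eq_iff by blast
  qed
  show ?thesis
    \<comment> \<open>The congruence rule supplies the positivity premises needed to rewrite with
      \<open>limit_iff\<close>; what remains is the duality of the quantifiers.\<close>
    by (simp only: limit_iff cong: imp_cong) blast
qed

end
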